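(* Let $\mathcal{T}$ be a staged tree such that any two vertices which are in the same stage are also in the same position. Then the corresponding staged tree model is toric, i.e. $\ker\varphi$ is a toric ideal.
   Context: A tree $\mathcal{T}=(V,E)$ is a finite directed rooted tree with root $v_0$ and at least one edge, edges directed away from the root, in which every vertex has either no or at least two outgoing edges. $E(v)\subseteq E$ is the set of edges going out of $v$. A staged tree is such a tree together with an edge labelling $e\mapsto\theta(e)$ and an equivalence relation $\sim$ on the non-leaf vertices ($v\sim w$ is read "$v$ and $w$ are in the same stage"), such that the edges out of one vertex have pairwise distinct labels, the sets of labels on $E(v)$ and $E(w)$ coincide if $v\sim w$, and these sets are disjoint if $v\not\sim w$. $\mathbb{R}[\Theta]=\mathbb{R}[\theta(e)\mid e\in E]$ is the polynomial ring with one indeterminate for each distinct label. Two vertices $v,w$ are in the same position if $v\sim w$ and the subtrees $\mathcal{T}(v)$ and $\mathcal{T}(w)$ (the induced subtrees rooted at $v$, resp. $w$, with root-to-leaf paths the $v$-to-leaf, resp. $w$-to-leaf, paths of $\mathcal{T}$) have the same parametrisation: up to the ordering of root-to-leaf paths, the lists of monomials in $\mathbb{R}[\Theta]$ obtained by multiplying the edge labels along each root-to-leaf path of $\mathcal{T}(v)$ and of $\mathcal{T}(w)$ are identical. Equivalently, $t(v)=t(w)$ in $\mathbb{R}[\Theta]$, where $t(v)$ is the sum of these monomials for $\mathcal{T}(v)$. Let $\lambda_1,\ldots,\lambda_n$ be the root-to-leaf paths of $\mathcal{T}$ and $E(\lambda_i)$ the edge set of $\lambda_i$. Let $$\varphi:\mathbb{R}[p_1,\ldots,p_n]\to\mathbb{R}[\Theta]/\langle\theta-1\rangle,\quad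 p_i\mapsto\prod_{e\in E(\lambda_i)}\theta(e),$$ where $\langle\theta-1\rangle=\langle\sum_{e\in E(v)}\theta(e)-1\mid v\in V\text{ non-leaf}\rangle$. Convention: $\ker\varphi$ is considered as a homogeneous ideal, that is, $\ker\varphi$ here denotes the ideal of $\mathbb{R}[p_1,\ldots,p_n]$ generated by all homogeneous polynomials (standard grading) mapped to $0$ by $\varphi$. The staged tree model is called toric if and only if $\ker\varphi$ is a toric ideal, i.e. the kernel of an $\mathbb{R}$-algebra homomorphism from $\mathbb{R}[p_1,\ldots,p_n]$ to a polynomial (or Laurent polynomial) ring sending each $p_i$ to a monomial. *)

theory Defs
  imports
    "HOL-Library.Multiset"
    "HOL-Library.Poly_Mapping"
    "HOL-Algebra.QuotRing"
    "Graph_Theory.Arc_Walk"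
begin

section \<open>Polynomial rings as subrings of polynomial mappings\<close>

text \<open>
  Real polynomials in indeterminates from \<open>'x\<close> are finitely supported maps from exponents
  \<open>'x \<Rightarrow>\<^sub>0 nat\<close> to coefficients; with exponents in \<open>'x \<Rightarrow>\<^sub>0 int\<close> one gets Laurent polynomials.
\<close>

type_synonym 'x mpoly_real = "('x \<Rightarrow>\<^sub>0 nat) \<Rightarrow>\<^sub>0 real"
type_synonym 'x laurent_real = "('x \<Rightarrow>\<^sub>0 int) \<Rightarrow>\<^sub>0 real"

definition poly_ring :: "'x set \<Rightarrow> (('x \<Rightarrow>\<^sub>0 'a::comm_monoid_add) \<Rightarrow>\<^sub>0 real) ring" where
  "poly_ring X =
     \<lparr>carrier = {f. \<forall>m\<in>Poly_Mapping.keys f. Poly_Mapping.keys m \<subseteq> X},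
      mult = (*), one = 1, zero = 0, add = (+)\<rparr>"

definition const_poly :: "real \<Rightarrow> (('x \<Rightarrow>\<^sub>0 'a::comm_monoid_add) \<Rightarrow>\<^sub>0 real)" where
  "const_poly c = Poly_Mapping.single 0 c"

definition indet :: "'x \<Rightarrow> 'x mpoly_real" where
  "indet x = Poly_Mapping.single (Poly_Mapping.single x 1) 1"

definition poly_subst :: "('i \<Rightarrow> 'x mpoly_real) \<Rightarrow> 'i mpoly_real \<Rightarrow> 'x mpoly_real" where
  "poly_subst g f =
     (\<Sum>m\<in>Poly_Mapping.keys f. const_poly (Poly_Mapping.lookup f m) *
        (\<Prod>i\<in>Poly_Mapping.keys m. g i ^ Poly_Mapping.lookup m i))"

definition exponent_degree :: "('x \<Rightarrow>\<^sub>0 nat) \<Rightarrow> nat" where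
  "exponent_degree m = (\<Sum>x\<in>Poly_Mapping.keys m. Poly_Mapping.lookup m x)"

definition homogeneous :: "'x mpoly_real \<Rightarrow> bool" where
  "homogeneous f \<longleftrightarrow> (\<exists>d. \<forall>m\<in>Poly_Mapping.keys f. exponent_degree m = d)"

text \<open>
  A monomial map is an algebra homomorphism (a ring homomorphism fixing the constants) that
  sends each indeterminate to a monomial with coefficient 1.  The exponent type \<open>'a\<close> decides
  whether its target is a polynomial ring (\<open>nat\<close>) or a Laurent polynomial ring (\<open>int\<close>).
\<close>

definition monomial_map ::
  "'i set \<Rightarrow> 'y set \<Rightarrow> ('i mpoly_real \<Rightarrow> (('y \<Rightarrow>\<^sub>0 'a::comm_monoid_add) \<Rightarrow>\<^sub>0 real)) \<Rightarrow> bool" where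
  "monomial_map X Y h \<longleftrightarrow>
     h \<in> ring_hom (poly_ring X) (poly_ring Y) \<and>
     (\<forall>c. h (const_poly c) = const_poly c) \<and>
     (\<forall>i\<in>X. \<exists>m. h (indet i) = Poly_Mapping.single m 1)"

definition toric_ideal :: "'i set \<Rightarrow> 'i mpoly_real set \<Rightarrow> bool" where
  "toric_ideal X I \<longleftrightarrow>
     (\<exists>k (h :: 'i mpoly_real \<Rightarrow> nat mpoly_real).
        monomial_map X {..<k} h \<and> I = a_kernel (poly_ring X) (poly_ring {..<k}) h) \<or>
     (\<exists>k (h :: 'i mpoly_real \<Rightarrow> nat laurent_real).
        monomial_map X {..<k} h \<and> I = a_kernel (poly_ring X) (poly_ring {..<k}) h)"


section \<open>Staged trees\<close>

definition inner_verts :: "('v, 'e) pre_digraph \<Rightarrow> 'v set" where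
  "inner_verts T = {v \<in> verts T. out_arcs T v \<noteq> {}}"

text \<open>
  A digraph is a tree directed away from its root iff every vertex is reached from the root by
  exactly one walk; this excludes parallel arcs, loops and cycles.
\<close>

locale event_tree = fin_digraph T for T :: "('v, 'e) pre_digraph" +
  fixes r :: 'v
  assumes root_in_verts: "r \<in> verts T"
    and unique_awalk: "v \<in> verts T \<Longrightarrow> \<exists>!p. awalk r p v"
    and arcs_nonempty: "arcs T \<noteq> {}"
    and out_degree_not_one: "v \<in> verts T \<Longrightarrow> out_degree T v = 0 \<or> out_degree T v \<ge> 2"

text \<open>The relation \<open>S\<close> is ``being in the same stage''.\<close>

locale staged_tree = event_tree T r for T :: "('v, 'e) pre_digraph" and r :: 'v +
  fixes \<theta> :: "'e \<Rightarrow> 'l" and S :: "('v \<times> 'v) set"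
  assumes equiv_stages: "equiv (inner_verts T) S"
    and inj_on_labels: "v \<in> inner_verts T \<Longrightarrow> inj_on \<theta> (out_arcs T v)"
    and same_stage_labels: "(v, w) \<in> S \<Longrightarrow> \<theta> ` out_arcs T v = \<theta> ` out_arcs T w"
    and different_stage_labels:
      "v \<in> inner_verts T \<Longrightarrow> w \<in> inner_verts T \<Longrightarrow> (v, w) \<notin> S \<Longrightarrow>
       \<theta> ` out_arcs T v \<inter> \<theta> ` out_arcs T w = {}"

text \<open>
  The \<open>v\<close>-to-leaf paths, as lists of arcs; in a tree they are the root-to-leaf paths of the
  subtree rooted at \<open>v\<close>.
\<close>

definition leaf_paths :: "('v, 'e) pre_digraph \<Rightarrow> 'v \<Rightarrow> 'e list set" where
  "leaf_paths T v = {p. \<exists>w \<in> verts T - inner_verts T. pre_digraph.awalk T v p w}"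

definition path_monomial :: "('e \<Rightarrow> 'l) \<Rightarrow> 'e list \<Rightarrow> 'l mpoly_real" where
  "path_monomial \<theta> p = (\<Prod>e\<in>set p. indet (\<theta> e))"

definition parametrisation ::
  "('v, 'e) pre_digraph \<Rightarrow> ('e \<Rightarrow> 'l) \<Rightarrow> 'v \<Rightarrow> 'l mpoly_real multiset" where
  "parametrisation T \<theta> v = image_mset (path_monomial \<theta>) (mset_set (leaf_paths T v))"

definition same_position ::
  "('v, 'e) pre_digraph \<Rightarrow> ('e \<Rightarrow> 'l) \<Rightarrow> ('v \<times> 'v) set \<Rightarrow> 'v \<Rightarrow> 'v \<Rightarrow> bool" where
  "same_position T \<theta> S v w \<longleftrightarrow> (v, w) \<in> S \<and> parametrisation T \<theta> v = parametrisation T \<theta> w"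


section \<open>The ideal of a staged tree model\<close>

abbreviation label_ring :: "('v, 'e) pre_digraph \<Rightarrow> ('e \<Rightarrow> 'l) \<Rightarrow> 'l mpoly_real ring" where
  "label_ring T \<theta> \<equiv> poly_ring (\<theta> ` arcs T)"

definition sum_to_one_ideal :: "('v, 'e) pre_digraph \<Rightarrow> ('e \<Rightarrow> 'l) \<Rightarrow> 'l mpoly_real set" where
  "sum_to_one_ideal T \<theta> =
     Idl\<^bsub>label_ring T \<theta>\<^esub> {(\<Sum>e\<in>out_arcs T v. indet (\<theta> e)) - 1 | v. v \<in> inner_verts T}"

text \<open>
  The indeterminates \<open>p\<^sub>1, \<dots>, p\<^sub>n\<close> are indexed by the root-to-leaf paths themselves
  instead of by an enumeration of them.
\<close>

abbreviation path_ring :: "('v, 'e) pre_digraph \<Rightarrow> 'v \<Rightarrow> 'e list mpoly_real ring" where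
  "path_ring T r \<equiv> poly_ring (leaf_paths T r)"

definition param_map ::
  "('v, 'e) pre_digraph \<Rightarrow> ('e \<Rightarrow> 'l) \<Rightarrow> 'e list mpoly_real \<Rightarrow> 'l mpoly_real set" where
  "param_map T \<theta> f = sum_to_one_ideal T \<theta> +>\<^bsub>label_ring T \<theta>\<^esub> poly_subst (path_monomial \<theta>) f"

text \<open>The ideal generated by the homogeneous elements of the kernel of \<open>param_map\<close>.\<close>

definition param_kernel ::
  "('v, 'e) pre_digraph \<Rightarrow> 'v \<Rightarrow> ('e \<Rightarrow> 'l) \<Rightarrow> 'e list mpoly_real set" where
  "param_kernel T r \<theta> =
     Idl\<^bsub>path_ring T r\<^esub>
       {f \<in> a_kernel (path_ring T r) (label_ring T \<theta> Quot sum_to_one_ideal T \<theta>) (param_map T \<theta>).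
          homogeneous f}"

definition toric_staged_tree_model ::
  "('v, 'e) pre_digraph \<Rightarrow> 'v \<Rightarrow> ('e \<Rightarrow> 'l) \<Rightarrow> bool" where
  "toric_staged_tree_model T r \<theta> \<longleftrightarrow> toric_ideal (leaf_paths T r) (param_kernel T r \<theta>)"

end

theory Submission
  imports Defs
begin

text \<open>
  The kernel \<open>ker \<phi>\<close> is compared with the kernel of the map \<open>p\<^sub>\<lambda> \<mapsto> m\<^sub>\<lambda>\<close> into \<open>\<real>[\<Theta>]\<close> itself, where
  \<open>m\<^sub>\<lambda>\<close> is the product of the labels along the path \<open>\<lambda>\<close>. The claim is that a homogeneous polynomial
  \<open>f\<close> with \<open>f(m)\<close> in \<open>\<langle>\<theta> - 1\<rangle>\<close> already satisfies \<open>f(m) = 0\<close>.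

  For a vertex \<open>v\<close> let \<open>t(v)\<close> be the sum of the path monomials of the subtree at \<open>v\<close>, so that
  \<open>t(v) = (\<Sum>e\<in>E(v). \<theta>(e) t(head e))\<close>, and consider the substitution
  \<open>\<theta>(e) \<mapsto> \<theta>(e) t(head e) / t(tail e)\<close>.

  \<^item> It is well defined on labels. Two edges with the same label start in the same stage, hence in the
    same position, so their tails have the same \<open>t\<close>. The labels at a vertex do not occur below it,
    because a vertex and a proper descendant cannot be in the same position: the descendant has
    fewer leaves below it. So \<open>t(head e)\<close> is the coefficient of \<open>\<theta>(e)\<close> in \<open>t(tail e)\<close>, which is the
    same for both edges (\<open>equal_labels_head_value\<close>).
  \<^item> It sends the sum of the labels at each vertex \<open>v\<close> to \<open>t(v) / t(v) = 1\<close>, so it kills \<open>\<langle>\<theta> - 1\<rangle>\<close>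
    (\<open>poly_eval_sum_to_one_ideal\<close>).
  \<^item> Along a root-to-leaf path the quotients telescope, so it sends \<open>m\<^sub>\<lambda>\<close> to \<open>m\<^sub>\<lambda> / t(r)\<close>, with the same
    denominator for all paths (\<open>prod_rescaled_leaf_path\<close>).

  If \<open>f\<close> is homogeneous of degree \<open>d\<close> and \<open>f(m)\<close> lies in \<open>\<langle>\<theta> - 1\<rangle>\<close>, the substitution gives
  \<open>0 = f(m) / t(r)^d\<close>, and so \<open>f(m) = 0\<close> (\<open>homogeneous_subst_in_sum_to_one_ideal\<close>).

  Thus \<open>ker \<phi>\<close> is generated by the homogeneous polynomials that vanish at the monomials \<open>m\<^sub>\<lambda>\<close>, and
  these generate the kernel of the monomial map \<open>p\<^sub>\<lambda> \<mapsto> z m\<^sub>\<lambda>\<close> with a new indeterminate \<open>z\<close>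
  (\<open>toric_ideal_homogeneous_monomial_relations\<close>).

  Rational functions are avoided by working with values: a polynomial is \<open>0\<close> if it vanishes at all
  positive real points (\<open>poly_eq_0_if_eval_eq_0\<close>), and at such points \<open>t(v) > 0\<close>.
\<close>

section \<open>Substitution and evaluation of polynomials\<close>

definition monomial_value :: "('x \<Rightarrow> 'b::comm_monoid_mult) \<Rightarrow> ('x \<Rightarrow>\<^sub>0 nat) \<Rightarrow> 'b" where
  "monomial_value g m = (\<Prod>x\<in>Poly_Mapping.keys m. g x ^ Poly_Mapping.lookup m x)"

lemma monomial_value_superset:
  assumes "finite A" "Poly_Mapping.keys m \<subseteq> A"
  shows "monomial_value g m = (\<Prod>x\<in>A. g x ^ Poly_Mapping.lookup m x)"
  unfolding monomial_value_def
  by (rule prod.mono_neutral_left) (use assms in \<open>auto simp: in_keys_iff\<close>)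

lemma monomial_value_0 [simp]: "monomial_value g 0 = 1"
  by (simp add: monomial_value_def)

lemma monomial_value_add: "monomial_value g (m + n) = monomial_value g m * monomial_value g n"
proof -
  let ?A = "Poly_Mapping.keys m \<union> Poly_Mapping.keys n"
  have "monomial_value g k = (\<Prod>x\<in>?A. g x ^ Poly_Mapping.lookup k x)" if "k \<in> {m, n, m + n}" for k
    by (rule monomial_value_superset) (use that Poly_Mapping.keys_add[of m n] in auto)
  then show ?thesis
    by (simp add: lookup_add power_add prod.distrib)
qed

lemma monomial_value_sum: "monomial_value g (sum m A) = (\<Prod>i\<in>A. monomial_value g (m i))"
  by (induction A rule: infinite_finite_induct) (simp_all add: monomial_value_add)

lemma monomial_value_single: "monomial_value g (Poly_Mapping.single x n) = g x ^ n"
  by (cases "n = 0") (simp_all add: monomial_value_def)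

lemma monomial_value_scaled:
  "monomial_value (\<lambda>x. s * g x) m = s ^ exponent_degree m * monomial_value g m"
  by (simp add: monomial_value_def exponent_degree_def power_mult_distrib prod.distrib power_sum)

text \<open>
  Substitution into polynomials and evaluation at real numbers are both instances of the algebra
  map out of a polynomial ring given by a map \<open>c\<close> on the coefficients and images \<open>g\<close> of the
  indeterminates.
\<close>

definition poly_extension ::
  "(real \<Rightarrow> 'b::comm_ring_1) \<Rightarrow> ('x \<Rightarrow> 'b) \<Rightarrow> 'x mpoly_real \<Rightarrow> 'b" where
  "poly_extension c g f =
     (\<Sum>m\<in>Poly_Mapping.keys f. c (Poly_Mapping.lookup f m) * monomial_value g m)"

abbreviation poly_eval :: "('x \<Rightarrow> real) \<Rightarrow> 'x mpoly_real \<Rightarrow> real" where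
  "poly_eval \<equiv> poly_extension (\<lambda>c. c)"

lemma poly_subst_eq_extension: "poly_subst g f = poly_extension const_poly g f"
  by (simp add: poly_subst_def poly_extension_def monomial_value_def)

lemma sum_of_terms:
  "(\<Sum>m\<in>Poly_Mapping.keys f. Poly_Mapping.single m (Poly_Mapping.lookup f m)) = f"
  by (rule poly_mapping_eqI)
     (simp add: lookup_sum lookup_single when_def in_keys_iff)

locale coefficient_hom =
  fixes c :: "real \<Rightarrow> 'b::comm_ring_1"
  assumes zero: "c 0 = 0" and one: "c 1 = 1"
    and add: "c (a + b) = c a + c b" and mult: "c (a * b) = c a * c b"
begin

lemma extension_superset:
  assumes "finite A" "Poly_Mapping.keys f \<subseteq> A"
  shows "poly_extension c g f = (\<Sum>m\<in>A. c (Poly_Mapping.lookup f m) * monomial_value g m)"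
  unfolding poly_extension_def
  by (rule sum.mono_neutral_left) (use assms zero in \<open>auto simp: in_keys_iff\<close>)

lemma extension_0 [simp]: "poly_extension c g 0 = 0"
  by (simp add: poly_extension_def)

lemma extension_add: "poly_extension c g (f + h) = poly_extension c g f + poly_extension c g h"
proof -
  let ?A = "Poly_Mapping.keys f \<union> Poly_Mapping.keys h"
  have "poly_extension c g k = (\<Sum>m\<in>?A. c (Poly_Mapping.lookup k m) * monomial_value g m)"
    if "k \<in> {f, h, f + h}" for k
    by (rule extension_superset) (use that Poly_Mapping.keys_add[of f h] in auto)
  then show ?thesis
    by (simp add: lookup_add add distrib_right sum.distrib)
qed

lemma extension_sum: "poly_extension c g (sum f A) = (\<Sum>i\<in>A. poly_extension c g (f i))"
  by (induction A rule: infinite_finite_induct) (simp_all add: extension_add)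

lemma extension_single: "poly_extension c g (Poly_Mapping.single m b) = c b * monomial_value g m"
  by (cases "b = 0") (simp_all add: poly_extension_def zero)

lemma extension_1 [simp]: "poly_extension c g 1 = 1"
  using extension_single[of g 0 1] by (simp add: one)

lemma extension_mult: "poly_extension c g (f * h) = poly_extension c g f * poly_extension c g h"
proof -
  let ?t = "\<lambda>f m. Poly_Mapping.single m (Poly_Mapping.lookup f m)"
  have "poly_extension c g (f * h) = poly_extension c g
      ((\<Sum>m\<in>Poly_Mapping.keys f. ?t f m) * (\<Sum>n\<in>Poly_Mapping.keys h. ?t h n))"
    by (simp only: sum_of_terms)
  also have "\<dots> = (\<Sum>m\<in>Poly_Mapping.keys f. \<Sum>n\<in>Poly_Mapping.keys h.
      poly_extension c g (?t f m) * poly_extension c g (?t h n))"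
    by (simp add: sum_product extension_sum mult_single extension_single mult monomial_value_add
        ac_simps)
  also have "\<dots> = poly_extension c g f * poly_extension c g h"
    by (simp only: sum_product[symmetric] extension_sum[symmetric] sum_of_terms)
  finally show ?thesis .
qed

lemma extension_power: "poly_extension c g (f ^ n) = poly_extension c g f ^ n"
  by (induction n) (simp_all add: extension_mult)

lemma extension_prod: "poly_extension c g (prod f A) = (\<Prod>i\<in>A. poly_extension c g (f i))"
  by (induction A rule: infinite_finite_induct) (simp_all add: extension_mult)

lemma extension_diff: "poly_extension c g (f - h) = poly_extension c g f - poly_extension c g h"
  using extension_add[of g "f - h" h] by simp

lemma extension_const: "poly_extension c g (const_poly b) = c b"
  by (simp add: const_poly_def extension_single)

lemma extension_indet: "poly_extension c g (indet x) = g x"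
  by (simp add: indet_def extension_single monomial_value_single one)

end

interpretation eval: coefficient_hom "\<lambda>c. c"
  by unfold_locales simp_all

interpretation subst: coefficient_hom "const_poly :: real \<Rightarrow> 'x mpoly_real"
  by unfold_locales (simp_all add: const_poly_def single_add mult_single)

lemma poly_eval_subst: "poly_eval a (poly_subst g f) = poly_eval (\<lambda>i. poly_eval a (g i)) f"
proof -
  have "poly_eval a (poly_subst g f) = (\<Sum>m\<in>Poly_Mapping.keys f. Poly_Mapping.lookup f m *
      (\<Prod>i\<in>Poly_Mapping.keys m. poly_eval a (g i) ^ Poly_Mapping.lookup m i))"
    by (simp add: poly_subst_def eval.extension_sum eval.extension_mult eval.extension_const
      eval.extension_prod eval.extension_power)
  also have "\<dots> = poly_eval (\<lambda>i. poly_eval a (g i)) f"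
    by (simp only: poly_extension_def[of _ _ f] monomial_value_def)
  finally show ?thesis .
qed

text \<open>
  Distinct monomials are linearly independent functions on the positive orthant, by the argument of
  Artin and Dedekind for characters: doubling one coordinate rescales each monomial by a power of
  2, so one term of a linear relation can be eliminated.
\<close>

lemma monomials_linearly_independent:
  fixes b :: "('x \<Rightarrow>\<^sub>0 nat) \<Rightarrow> real"
  assumes "finite M"
    and "\<And>a :: 'x \<Rightarrow> real. (\<And>x. a x > 0) \<Longrightarrow> (\<Sum>m\<in>M. b m * monomial_value a m) = 0"
    and "m \<in> M"
  shows "b m = 0"
  using assms
proof (induction M arbitrary: b m rule: finite_induct)
  case empty
  then show ?case by simp
next
  case (insert k M)
  have vanish: "b n = 0" if "n \<in> M" for n
  proof -
    from that insert.hyps have "n \<noteq> k" by auto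
    then obtain x where x: "Poly_Mapping.lookup n x \<noteq> Poly_Mapping.lookup k x"
      using poly_mapping_eqI[of n k] by blast
    define b' where "b' l = b l * (2 ^ Poly_Mapping.lookup l x - 2 ^ Poly_Mapping.lookup k x)" for l
    have "(\<Sum>l\<in>M. b' l * monomial_value a l) = 0" if a: "\<And>y. a y > 0" for a :: "'x \<Rightarrow> real"
    proof -
      define a' where "a' y = (if y = x then 2 else 1) * a y" for y
      have pos: "a' y > 0" for y
        using a by (simp add: a'_def)
      have a': "monomial_value a' l = 2 ^ Poly_Mapping.lookup l x * monomial_value a l" for l
      proof -
        have "monomial_value a' l = (\<Prod>y\<in>Poly_Mapping.keys l.
            if y = x then 2 ^ Poly_Mapping.lookup l x else 1) * monomial_value a l"
          unfolding monomial_value_def prod.distrib[symmetric]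
          by (rule prod.cong) (auto simp: a'_def power_mult_distrib)
        then show ?thesis
          by (simp add: prod.delta in_keys_iff)
      qed
      have "(\<Sum>l\<in>insert k M. b l * monomial_value a' l)
          - 2 ^ Poly_Mapping.lookup k x * (\<Sum>l\<in>insert k M. b l * monomial_value a l) = 0"
        using insert.prems(1)[OF a] insert.prems(1)[of a', OF pos] by simp
      also have "(\<Sum>l\<in>insert k M. b l * monomial_value a' l)
          - 2 ^ Poly_Mapping.lookup k x * (\<Sum>l\<in>insert k M. b l * monomial_value a l)
          = (\<Sum>l\<in>insert k M. b' l * monomial_value a l)"
        by (simp add: a' b'_def sum_distrib_left sum_subtractf[symmetric] algebra_simps
            del: sum.insert)
      also have "\<dots> = (\<Sum>l\<in>M. b' l * monomial_value a l)"
        using insert.hyps by (simp add: b'_def)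
      finally show ?thesis .
    qed
    from insert.IH[OF this \<open>n \<in> M\<close>] x show ?thesis
      by (simp add: b'_def)
  qed
  have "b k = 0"
    using insert.prems(1)[of "\<lambda>_. 1"] insert.hyps vanish
    by (simp add: monomial_value_def)
  with vanish insert.prems(2) show ?case by auto
qed

lemma poly_eq_0_if_eval_eq_0:
  assumes "\<And>a. (\<And>x. a x > 0) \<Longrightarrow> poly_eval a f = 0"
  shows "f = 0"
proof (rule poly_mapping_eqI)
  fix m
  show "Poly_Mapping.lookup f m = Poly_Mapping.lookup 0 m"
    using monomials_linearly_independent[of "Poly_Mapping.keys f" "Poly_Mapping.lookup f" m] assms
    by (cases "m \<in> Poly_Mapping.keys f") (auto simp: poly_extension_def in_keys_iff)
qed


section \<open>Polynomial rings and their ideals\<close>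

lemma carrier_poly_ring:
  "f \<in> carrier (poly_ring X) \<longleftrightarrow> (\<forall>m\<in>Poly_Mapping.keys f. Poly_Mapping.keys m \<subseteq> X)"
  by (simp add: poly_ring_def)

lemma poly_ring_simps [simp]:
  "mult (poly_ring X) = (*)" "one (poly_ring X) = 1" "zero (poly_ring X) = 0"
  "add (poly_ring X) = (+)"
  by (simp_all add: poly_ring_def)

context
  fixes X :: "'x set"
begin

private abbreviation (input) "P \<equiv> carrier (poly_ring X) :: 'x mpoly_real set"

lemma poly_ring_single: "Poly_Mapping.keys m \<subseteq> X \<Longrightarrow> Poly_Mapping.single m c \<in> P"
  by (simp add: carrier_poly_ring)

lemma poly_ring_const: "const_poly c \<in> P"
  by (simp add: const_poly_def poly_ring_single)

lemma poly_ring_0: "0 \<in> P"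
  by (simp add: carrier_poly_ring)

lemma poly_ring_1: "1 \<in> P"
  by (simp add: carrier_poly_ring)

lemma poly_ring_indet: "x \<in> X \<Longrightarrow> indet x \<in> P"
  by (simp add: indet_def poly_ring_single)

lemma poly_ring_add: "f \<in> P \<Longrightarrow> g \<in> P \<Longrightarrow> f + g \<in> P"
  using Poly_Mapping.keys_add[of f g] by (fastforce simp: carrier_poly_ring)

lemma poly_ring_uminus: "f \<in> P \<Longrightarrow> - f \<in> P"
  by (simp add: carrier_poly_ring in_keys_iff)

lemma poly_ring_diff: "f \<in> P \<Longrightarrow> g \<in> P \<Longrightarrow> f - g \<in> P"
  using poly_ring_add[of f "- g"] poly_ring_uminus by simp

lemma poly_ring_mult:
  assumes "f \<in> P" "g \<in> P"
  shows "f * g \<in> P"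
  unfolding carrier_poly_ring
proof
  fix m
  assume "m \<in> Poly_Mapping.keys (f * g)"
  then obtain a b where "m = a + b" "a \<in> Poly_Mapping.keys f" "b \<in> Poly_Mapping.keys g"
    using keys_mult[of f g] by blast
  then show "Poly_Mapping.keys m \<subseteq> X"
    using assms Poly_Mapping.keys_add[of a b] by (fastforce simp: carrier_poly_ring)
qed

lemma poly_ring_sum: "(\<And>i. i \<in> A \<Longrightarrow> f i \<in> P) \<Longrightarrow> sum f A \<in> P"
  by (induction A rule: infinite_finite_induct) (simp_all add: poly_ring_0 poly_ring_add)

lemma poly_ring_prod: "(\<And>i. i \<in> A \<Longrightarrow> f i \<in> P) \<Longrightarrow> prod f A \<in> P"
  by (induction A rule: infinite_finite_induct) (simp_all add: poly_ring_1 poly_ring_mult)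

lemma poly_ring_power: "f \<in> P \<Longrightarrow> f ^ n \<in> P"
  by (induction n) (simp_all add: poly_ring_1 poly_ring_mult)

lemma poly_ring_cring: "cring (poly_ring X :: 'x mpoly_real ring)"
proof (rule cringI)
  show "abelian_group (poly_ring X :: 'x mpoly_real ring)"
    by (rule abelian_groupI)
       (auto simp: poly_ring_add poly_ring_0 ac_simps
          intro: bexI[where x="- x" for x] poly_ring_uminus)
  show "comm_monoid (poly_ring X :: 'x mpoly_real ring)"
    by (rule comm_monoidI) (auto simp: poly_ring_mult poly_ring_1 ac_simps)
qed (simp add: distrib_right)

lemma poly_subst_in_poly_ring:
  assumes "f \<in> carrier (poly_ring Z)" "\<And>i. i \<in> Z \<Longrightarrow> g i \<in> P"
  shows "poly_subst g f \<in> P"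
  unfolding poly_subst_def
  by (intro poly_ring_sum poly_ring_mult poly_ring_const poly_ring_prod poly_ring_power assms(2))
     (use assms(1) in \<open>auto simp: carrier_poly_ring\<close>)

lemma poly_extension_cong:
  assumes "f \<in> P" "\<And>x. x \<in> X \<Longrightarrow> g x = h x"
  shows "poly_extension c g f = poly_extension c h f"
  unfolding poly_extension_def monomial_value_def
  by (intro sum.cong prod.cong arg_cong2[where f="(*)"] refl arg_cong2[where f="(^)"] assms(2))
     (use assms(1) in \<open>auto simp: carrier_poly_ring\<close>)

text \<open>Applied to evaluation at a point and to substitution maps.\<close>

lemma zero_set_ideal:
  fixes \<phi> :: "'x mpoly_real \<Rightarrow> 'b::comm_ring_1"
  assumes add: "\<And>f g. \<phi> (f + g) = \<phi> f + \<phi> g" and mult: "\<And>f g. \<phi> (f * g) = \<phi> f * \<phi> g"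
  shows "ideal {f \<in> P. \<phi> f = 0} (poly_ring X)"
proof -
  interpret R: cring "poly_ring X :: 'x mpoly_real ring" by (rule poly_ring_cring)
  have zero: "\<phi> 0 = 0" using add[of 0 0] by simp
  have uminus: "\<phi> (- f) = - \<phi> f" for f
    using add[of f "- f"] zero by (simp add: eq_neg_iff_add_eq_0 add.commute)
  have inv: "\<ominus>\<^bsub>poly_ring X\<^esub> f = - f" if "f \<in> P" for f :: "'x mpoly_real"
    by (rule R.minus_equality) (use that poly_ring_uminus in auto)
  show ?thesis
  proof (rule idealI[OF R.ring_axioms])
    show "subgroup {f \<in> P. \<phi> f = 0} (add_monoid (poly_ring X))"
    proof (rule R.add.subgroupI)
      show "\<ominus>\<^bsub>poly_ring X\<^esub> f \<in> {f \<in> P. \<phi> f = 0}" if "f \<in> {f \<in> P. \<phi> f = 0}" for f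
        using that inv[of f] by (simp add: uminus poly_ring_uminus)
    qed (use zero poly_ring_0 in \<open>auto simp: add poly_ring_add\<close>)
  qed (simp_all add: mult poly_ring_mult)
qed

lemma ideal_sum_closed:
  assumes "ideal I (poly_ring X)" "\<And>i. i \<in> A \<Longrightarrow> f i \<in> I"
  shows "sum f A \<in> (I :: 'x mpoly_real set)"
proof -
  interpret ideal I "poly_ring X" by fact
  have "0 \<in> I" "\<And>f g. f \<in> I \<Longrightarrow> g \<in> I \<Longrightarrow> f + g \<in> I"
    using additive_subgroup.zero_closed[OF additive_subgroup_axioms]
      additive_subgroup.a_closed[OF additive_subgroup_axioms] by auto
  with assms(2) show ?thesis
    by (induction A rule: infinite_finite_induct) auto
qed

end


section \<open>Homogeneous relations among monomials\<close>

definition homogeneous_part :: "nat \<Rightarrow> 'x mpoly_real \<Rightarrow> 'x mpoly_real" where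
  "homogeneous_part d f =
     (\<Sum>m | m \<in> Poly_Mapping.keys f \<and> exponent_degree m = d.
        Poly_Mapping.single m (Poly_Mapping.lookup f m))"

lemma keys_homogeneous_part:
  "Poly_Mapping.keys (homogeneous_part d f) \<subseteq> {m \<in> Poly_Mapping.keys f. exponent_degree m = d}"
  unfolding homogeneous_part_def by (rule order.trans[OF Poly_Mapping.keys_sum]) auto

lemma homogeneous_homogeneous_part: "homogeneous (homogeneous_part d f)"
  unfolding homogeneous_def using keys_homogeneous_part by blast

lemma homogeneous_part_in_poly_ring:
  "f \<in> carrier (poly_ring X) \<Longrightarrow> homogeneous_part d f \<in> carrier (poly_ring X)"
  using keys_homogeneous_part unfolding carrier_poly_ring by blast

lemma sum_homogeneous_parts:
  obtains N where "(\<Sum>d\<le>N. homogeneous_part d f) = f"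
proof
  let ?N = "Max (exponent_degree ` Poly_Mapping.keys f)"
  have "(\<Sum>d\<le>?N. homogeneous_part d f) =
      (\<Sum>m\<in>Poly_Mapping.keys f. Poly_Mapping.single m (Poly_Mapping.lookup f m))"
    unfolding homogeneous_part_def by (rule sum.group) auto
  then show "(\<Sum>d\<le>?N. homogeneous_part d f) = f"
    by (simp only: sum_of_terms)
qed

lemma poly_eval_scaled_of_degree:
  assumes "\<And>m. m \<in> Poly_Mapping.keys f \<Longrightarrow> exponent_degree m = d"
  shows "poly_eval (\<lambda>x. s * a x) f = s ^ d * poly_eval a f"
  by (simp add: poly_extension_def monomial_value_scaled assms sum_distrib_left ac_simps)

lemma poly_eval_scaled_homogeneous:
  assumes "homogeneous f" "s \<noteq> 0"
  shows "poly_eval (\<lambda>x. s * a x) f = 0 \<longleftrightarrow> poly_eval a f = 0"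
  using assms poly_eval_scaled_of_degree[of f] unfolding homogeneous_def by fastforce

text \<open>
  As a function of \<open>s\<close>, the value of \<open>f\<close> at \<open>s * a\<close> is a polynomial whose coefficient of \<open>s ^ d\<close> is
  the value of the \<open>d\<close>-th homogeneous part at \<open>a\<close>.
\<close>

lemma poly_eval_homogeneous_part_eq_0:
  assumes "\<And>s. poly_eval (\<lambda>x. s * a x) f = 0"
  shows "poly_eval a (homogeneous_part d f) = 0"
proof -
  let ?g = "\<lambda>d. homogeneous_part d f"
  obtain N where N: "(\<Sum>d\<le>N. ?g d) = f"
    by (rule sum_homogeneous_parts)
  have "(\<Sum>d\<le>N. poly_eval a (?g d) * s ^ d) = 0" for s
  proof -
    have "poly_eval (\<lambda>x. s * a x) (?g d) = poly_eval a (?g d) * s ^ d" for d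
      using poly_eval_scaled_of_degree[of "?g d" d s a] keys_homogeneous_part by fastforce
    then have "(\<Sum>d\<le>N. poly_eval a (?g d) * s ^ d) = poly_eval (\<lambda>x. s * a x) (\<Sum>d\<le>N. ?g d)"
      by (simp add: eval.extension_sum)
    then show ?thesis
      using assms by (simp add: N)
  qed
  then have "\<forall>d\<le>N. poly_eval a (?g d) = 0"
    using polyfun_eq_0[where n = N and c = "\<lambda>d. poly_eval a (?g d)"] by blast
  moreover have "?g d = 0" if "d > N"
  proof -
    have "m \<notin> Poly_Mapping.keys f" if "exponent_degree m = d" for m
    proof
      assume "m \<in> Poly_Mapping.keys f"
      then obtain d' where "d' \<le> N" "m \<in> Poly_Mapping.keys (?g d')"
        using Poly_Mapping.keys_sum[of ?g "{..N}"] unfolding N by auto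
      then show False
        using keys_homogeneous_part[of d' f] that \<open>d > N\<close> by auto
    qed
    then have "{m \<in> Poly_Mapping.keys f. exponent_degree m = d} = {}"
      by blast
    then show ?thesis
      unfolding homogeneous_part_def by (simp only: sum.empty)
  qed
  ultimately show ?thesis
    by (cases "d \<le> N") auto
qed

text \<open>
  A new indeterminate \<open>z\<close> makes the kernel of a monomial map homogeneous: the power of \<open>z\<close> in the
  image of a monomial records its degree.  Hence the homogeneous elements of the kernel of
  \<open>p\<^sub>i \<mapsto> m\<^sub>i\<close> generate the kernel of \<open>p\<^sub>i \<mapsto> z m\<^sub>i\<close>.
\<close>

proposition toric_ideal_homogeneous_monomial_relations:
  fixes X :: "'i set" and Y :: "'x set" and m :: "'i \<Rightarrow> 'x \<Rightarrow>\<^sub>0 nat"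
  assumes "finite Y" and keys_m: "\<And>i. i \<in> X \<Longrightarrow> Poly_Mapping.keys (m i) \<subseteq> Y"
  shows "toric_ideal X (Idl\<^bsub>poly_ring X\<^esub> {f \<in> carrier (poly_ring X).
           homogeneous f \<and> poly_subst (\<lambda>i. Poly_Mapping.single (m i) 1) f = 0})"
    (is "toric_ideal X (Idl\<^bsub>_\<^esub> ?G)")
proof -
  interpret R: cring "poly_ring X :: 'i mpoly_real ring"
    by (rule poly_ring_cring)
  define n where "n = card Y"
  obtain idx where idx: "bij_betw idx Y {..<n}"
    using ex_bij_betw_finite_nat[OF assms(1)] unfolding n_def lessThan_atLeast0 by blast
  \<comment> \<open>The indeterminate \<open>z\<close> gets the index \<open>0\<close>, the element \<open>y\<close> of \<open>Y\<close> the index \<open>Suc (idx y)\<close>.\<close>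
  define \<mu> :: "'i \<Rightarrow> nat \<Rightarrow>\<^sub>0 nat" where
    "\<mu> i = Poly_Mapping.single 0 1 +
      (\<Sum>y\<in>Poly_Mapping.keys (m i). Poly_Mapping.single (Suc (idx y)) (Poly_Mapping.lookup (m i) y))"
    for i
  define h where "h = poly_subst (\<lambda>i. Poly_Mapping.single (\<mu> i) (1::real))"
  have value_\<mu>: "monomial_value \<alpha> (\<mu> i) = \<alpha> 0 * monomial_value (\<lambda>y. \<alpha> (Suc (idx y))) (m i)"
    for \<alpha> :: "nat \<Rightarrow> real" and i
    by (simp add: \<mu>_def monomial_value_add monomial_value_sum monomial_value_single
        monomial_value_def[of _ "m i"])
  have eval_h: "poly_eval \<alpha> (h f) =
      poly_eval (\<lambda>i. \<alpha> 0 * monomial_value (\<lambda>y. \<alpha> (Suc (idx y))) (m i)) f" for \<alpha> f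
    by (simp add: h_def poly_eval_subst eval.extension_single value_\<mu>)
  have eval_m: "poly_eval a (poly_subst (\<lambda>i. Poly_Mapping.single (m i) 1) f) =
      poly_eval (\<lambda>i. monomial_value a (m i)) f" for a f
    by (simp add: poly_eval_subst eval.extension_single)
  have "Poly_Mapping.keys (\<mu> i) \<subseteq> {..<Suc n}" if "i \<in> X" for i
  proof -
    have "Poly_Mapping.keys (\<mu> i) \<subseteq> insert 0 (Suc ` idx ` Poly_Mapping.keys (m i))"
      unfolding \<mu>_def
      by (rule order.trans[OF Poly_Mapping.keys_add])
         (auto dest!: subsetD[OF Poly_Mapping.keys_sum] split: if_splits)
    then show ?thesis
      using keys_m[OF that] idx by (fastforce simp: bij_betw_def)
  qed
  then have h_in: "h f \<in> carrier (poly_ring {..<Suc n})" if "f \<in> carrier (poly_ring X)" for f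
    unfolding h_def using that by (auto intro: poly_subst_in_poly_ring poly_ring_single)
  have h_add: "h (f + g) = h f + h g" and h_mult: "h (f * g) = h f * h g" and h_1: "h 1 = 1" for f g
    by (simp_all add: h_def poly_subst_eq_extension subst.extension_add subst.extension_mult)
  have "monomial_map X {..<Suc n} h"
    unfolding monomial_map_def
  proof (intro conjI ballI allI)
    show "h \<in> ring_hom (poly_ring X) (poly_ring {..<Suc n})"
      by (rule ring_hom_memI) (simp_all add: h_in h_add h_mult h_1)
    show "h (const_poly c) = const_poly c" for c
      by (simp add: h_def poly_subst_eq_extension subst.extension_const)
    show "\<exists>k. h (indet i) = Poly_Mapping.single k 1" for i
      by (auto simp: h_def poly_subst_eq_extension subst.extension_indet)
  qed
  moreover have "Idl\<^bsub>poly_ring X\<^esub> ?G = {f \<in> carrier (poly_ring X). h f = 0}"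
  proof
    show "Idl\<^bsub>poly_ring X\<^esub> ?G \<subseteq> {f \<in> carrier (poly_ring X). h f = 0}"
    proof (rule R.genideal_minimal)
      show "ideal {f \<in> carrier (poly_ring X). h f = 0} (poly_ring X)"
        by (rule zero_set_ideal) (rule h_add h_mult)+
      show "?G \<subseteq> {f \<in> carrier (poly_ring X). h f = 0}"
      proof safe
        fix f :: "'i mpoly_real"
        assume f: "homogeneous f" "poly_subst (\<lambda>i. Poly_Mapping.single (m i) 1) f = 0"
        show "h f = 0"
        proof (rule poly_eq_0_if_eval_eq_0)
          fix \<alpha> :: "nat \<Rightarrow> real"
          assume "\<And>k. \<alpha> k > 0"
          then have "\<alpha> 0 \<noteq> 0"
            by (metis less_irrefl)
          with f show "poly_eval \<alpha> (h f) = 0"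
            by (simp add: eval_h poly_eval_scaled_homogeneous flip: eval_m)
        qed
      qed
    qed
    have ideal: "ideal (Idl\<^bsub>poly_ring X\<^esub> ?G) (poly_ring X)"
      by (rule R.genideal_ideal) auto
    show "{f \<in> carrier (poly_ring X). h f = 0} \<subseteq> Idl\<^bsub>poly_ring X\<^esub> ?G"
    proof safe
      fix f :: "'i mpoly_real"
      assume f: "f \<in> carrier (poly_ring X)" "h f = 0"
      have "homogeneous_part d f \<in> ?G" for d
      proof -
        have "poly_subst (\<lambda>i. Poly_Mapping.single (m i) 1) (homogeneous_part d f) = 0"
        proof (rule poly_eq_0_if_eval_eq_0)
          fix a :: "'x \<Rightarrow> real"
          \<comment> \<open>Any value \<open>s\<close> of \<open>z\<close> can be combined with the values \<open>a\<close> of the other indeterminates.\<close>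
          have "poly_eval (\<lambda>i. s * monomial_value a (m i)) f = 0" for s
          proof -
            define \<alpha> where "\<alpha> = case_nat s (\<lambda>k. a (inv_into Y idx k))"
            have "monomial_value (\<lambda>y. \<alpha> (Suc (idx y))) (m i) = monomial_value a (m i)" if "i \<in> X" for i
              unfolding monomial_value_def
            proof (rule prod.cong)
              fix y
              assume "y \<in> Poly_Mapping.keys (m i)"
              with keys_m[OF that] idx show "\<alpha> (Suc (idx y)) ^ Poly_Mapping.lookup (m i) y =
                  a y ^ Poly_Mapping.lookup (m i) y"
                by (auto simp: \<alpha>_def bij_betw_def inv_into_f_f)
            qed simp
            then have "poly_eval (\<lambda>i. s * monomial_value a (m i)) f = poly_eval \<alpha> (h f)"
              unfolding eval_h by (intro poly_extension_cong[OF f(1)]) (simp add: \<alpha>_def)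
            then show ?thesis
              by (simp add: f(2))
          qed
          then show "poly_eval a (poly_subst (\<lambda>i. Poly_Mapping.single (m i) 1)
              (homogeneous_part d f)) = 0"
            unfolding eval_m by (rule poly_eval_homogeneous_part_eq_0)
        qed
        then show ?thesis
          using f(1) by (simp add: homogeneous_part_in_poly_ring homogeneous_homogeneous_part)
      qed
      moreover have "?G \<subseteq> Idl\<^bsub>poly_ring X\<^esub> ?G"
        by (rule R.genideal_self) auto
      ultimately have "homogeneous_part d f \<in> Idl\<^bsub>poly_ring X\<^esub> ?G" for d
        by blast
      then have sums: "(\<Sum>d\<le>N. homogeneous_part d f) \<in> Idl\<^bsub>poly_ring X\<^esub> ?G" for N
        by (intro ideal_sum_closed[OF ideal])
      obtain N where "(\<Sum>d\<le>N. homogeneous_part d f) = f"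
        by (rule sum_homogeneous_parts)
      with sums[of N] show "f \<in> Idl\<^bsub>poly_ring X\<^esub> ?G"
        by (simp only:)
    qed
  qed
  ultimately show ?thesis
    unfolding toric_ideal_def by (intro disjI1 exI[of _ "Suc n"] exI[of _ h]) (simp add: a_kernel_def')
qed


section \<open>Walks to the leaves of a tree\<close>

definition subtree_value ::
  "('v, 'e) pre_digraph \<Rightarrow> ('e \<Rightarrow> 'l) \<Rightarrow> ('l \<Rightarrow> real) \<Rightarrow> 'v \<Rightarrow> real" where
  "subtree_value T \<theta> a v = (\<Sum>p\<in>leaf_paths T v. \<Prod>e\<in>set p. a (\<theta> e))"

context event_tree
begin

text \<open>Going round a closed walk would give a second walk from the root.\<close>

lemma closed_awalk_Nil:
  assumes "awalk v p v"
  shows "p = []"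
proof -
  from assms have "v \<in> verts T" by blast
  then obtain q where "awalk r q v"
    using unique_awalk by blast
  moreover from this assms have "awalk r (q @ p) v"
    by (rule awalk_appendI)
  ultimately have "q @ p = q"
    using unique_awalk \<open>v \<in> verts T\<close> by blast
  then show ?thesis by simp
qed

lemma awalk_append_ConsE:
  assumes "awalk v (p @ e # q) w"
  shows "awalk v p (tail T e)" "e \<in> arcs T" "awalk (head T e) q w"
proof -
  have p: "awalk v p (awlast v p)" and q: "awalk (awlast v p) (e # q) w"
    using assms unfolding awalk_append_iff by blast+
  from q show "e \<in> arcs T" "awalk (head T e) q w"
    unfolding awalk_Cons_iff by blast+
  from p q show "awalk v p (tail T e)"
    unfolding awalk_Cons_iff by simp
qed

lemma distinct_awalk: "awalk v p w \<Longrightarrow> distinct p"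
proof (induction p arbitrary: v)
  case (Cons e p)
  have "e \<notin> set p"
  proof
    assume "e \<in> set p"
    then obtain p1 p2 where "p = p1 @ e # p2"
      by (meson split_list)
    with Cons.prems have "awalk v (e # p1) (tail T e)"
      using awalk_append_ConsE(1)[of v "e # p1" e p2 w] by simp
    moreover from this have "v = tail T e"
      unfolding awalk_Cons_iff by blast
    ultimately have "awalk (tail T e) (e # p1) (tail T e)"
      by simp
    then show False
      using closed_awalk_Nil by blast
  qed
  moreover have "distinct p"
    using Cons.IH Cons.prems unfolding awalk_Cons_iff by blast
  ultimately show ?case by simp
qed simp

lemma awalk_subset_arcs: "awalk v p w \<Longrightarrow> set p \<subseteq> arcs T"
  by (simp add: awalk_def)

lemma finite_awalks: "finite {p. \<exists>w. awalk v p w}"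
proof (rule finite_subset)
  show "{p. \<exists>w. awalk v p w} \<subseteq> {p. set p \<subseteq> arcs T \<and> distinct p}"
    using awalk_subset_arcs distinct_awalk by blast
qed (rule finite_subset_distinct[OF finite_arcs])

lemma in_leaf_paths_iff:
  "p \<in> leaf_paths T v \<longleftrightarrow> (\<exists>w. w \<in> verts T \<and> w \<notin> inner_verts T \<and> awalk v p w)"
  unfolding leaf_paths_def by blast

lemma finite_leaf_paths: "finite (leaf_paths T v)"
  by (rule finite_subset[OF _ finite_awalks[of v]]) (use in_leaf_paths_iff in blast)

lemma leaf_path_subset_arcs: "p \<in> leaf_paths T v \<Longrightarrow> set p \<subseteq> arcs T"
  unfolding in_leaf_paths_iff using awalk_subset_arcs by blast

lemma distinct_leaf_path: "p \<in> leaf_paths T v \<Longrightarrow> distinct p"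
  unfolding in_leaf_paths_iff using distinct_awalk by blast

lemma Nil_in_leaf_paths_iff: "[] \<in> leaf_paths T v \<longleftrightarrow> v \<in> verts T \<and> v \<notin> inner_verts T"
  unfolding in_leaf_paths_iff awalk_Nil_iff by blast

lemma Cons_in_leaf_paths_iff:
  "e # p \<in> leaf_paths T v \<longleftrightarrow> e \<in> out_arcs T v \<and> p \<in> leaf_paths T (head T e)"
  unfolding in_leaf_paths_iff awalk_Cons_iff in_out_arcs_conv by blast

lemma append_in_leaf_paths:
  "awalk v p w \<Longrightarrow> q \<in> leaf_paths T w \<Longrightarrow> p @ q \<in> leaf_paths T v"
  unfolding in_leaf_paths_iff using awalk_appendI by blast

lemma out_arc_inner_verts: "e \<in> out_arcs T v \<Longrightarrow> v \<in> inner_verts T"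
  unfolding inner_verts_def by fastforce

lemma leaf_paths_leaf:
  assumes "v \<in> verts T" "v \<notin> inner_verts T"
  shows "leaf_paths T v = {[]}"
proof -
  have "p = []" if "p \<in> leaf_paths T v" for p
    using that assms(2) out_arc_inner_verts by (cases p) (simp, metis Cons_in_leaf_paths_iff)
  then show ?thesis
    using assms Nil_in_leaf_paths_iff by blast
qed

lemma leaf_paths_inner:
  assumes "v \<in> inner_verts T"
  shows "leaf_paths T v = (\<Union>e\<in>out_arcs T v. (#) e ` leaf_paths T (head T e))"
proof (rule Set.set_eqI)
  fix p
  show "p \<in> leaf_paths T v \<longleftrightarrow> p \<in> (\<Union>e\<in>out_arcs T v. (#) e ` leaf_paths T (head T e))"
  proof (cases p)
    case Nil
    with assms show ?thesis
      by (auto simp: Nil_in_leaf_paths_iff)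
  next
    case (Cons e q)
    then show ?thesis
      unfolding Cons Cons_in_leaf_paths_iff by blast
  qed
qed

text \<open>A longest walk from \<open>v\<close> ends in a leaf.\<close>

lemma leaf_paths_nonempty:
  assumes "v \<in> verts T"
  shows "leaf_paths T v \<noteq> {}"
proof -
  let ?A = "{p. \<exists>w. awalk v p w}"
  have "[] \<in> ?A"
    using assms by (auto simp: awalk_Nil_iff)
  then have "Max (length ` ?A) \<in> length ` ?A"
    using finite_awalks[of v] by (intro Max_in) auto
  then obtain p w where p: "awalk v p w" "length p = Max (length ` ?A)"
    by auto
  have "out_arcs T w = {}"
  proof (rule ccontr)
    assume "out_arcs T w \<noteq> {}"
    then obtain e where "e \<in> out_arcs T w"
      by blast
    then have "awalk w [e] (head T e)"
      by (simp add: awalk_Cons_iff awalk_Nil_iff)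
    then have "awalk v (p @ [e]) (head T e)"
      by (rule awalk_appendI[OF p(1)])
    then have "length (p @ [e]) \<le> Max (length ` ?A)"
      by (intro Max_ge finite_imageI finite_awalks imageI CollectI exI)
    with p(2) show False by simp
  qed
  then have "w \<notin> inner_verts T"
    by (simp add: inner_verts_def)
  with p(1) have "p \<in> leaf_paths T v"
    unfolding in_leaf_paths_iff using awalk_last_in_verts by blast
  then show ?thesis by blast
qed

text \<open>
  Prefixing \<open>p\<close> embeds the leaf paths of \<open>w\<close> into those of \<open>v\<close>. Since \<open>v\<close> has a second outgoing edge,
  a path that starts with this edge is missed.
\<close>

lemma card_leaf_paths_less:
  assumes "awalk v p w" "p \<noteq> []"
  shows "card (leaf_paths T w) < card (leaf_paths T v)"
proof -
  obtain e q where p: "p = e # q"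
    using assms(2) by (cases p) auto
  with assms(1) have e: "e \<in> out_arcs T v"
    unfolding awalk_Cons_iff p by simp
  have v: "v \<in> verts T"
    using assms(1) by (rule awalk_hd_in_verts)
  have fin: "finite (out_arcs T v)"
    by (rule finite_out_arcs)
  then have "out_degree T v \<noteq> 0"
    using e by (auto simp: out_degree_def)
  then have "card (out_arcs T v) \<ge> 2"
    using out_degree_not_one[OF v] by (simp add: out_degree_def)
  then have "\<not> out_arcs T v \<subseteq> {e}"
    using card_mono[of "{e}" "out_arcs T v"] by auto
  then obtain e' where e': "e' \<in> out_arcs T v" "e' \<noteq> e"
    by blast
  then have "head T e' \<in> verts T"
    by simp
  then obtain q' where "q' \<in> leaf_paths T (head T e')"
    using leaf_paths_nonempty by blast
  with e' have "e' # q' \<in> leaf_paths T v"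
    unfolding Cons_in_leaf_paths_iff by blast
  moreover have "e' # q' \<notin> (@) p ` leaf_paths T w"
    using e' by (auto simp: p)
  moreover have "(@) p ` leaf_paths T w \<subseteq> leaf_paths T v"
    using append_in_leaf_paths[OF assms(1)] by blast
  ultimately have "(@) p ` leaf_paths T w \<subset> leaf_paths T v"
    by blast
  then have "card ((@) p ` leaf_paths T w) < card (leaf_paths T v)"
    by (intro psubset_card_mono finite_leaf_paths)
  then show ?thesis
    by (simp add: card_image inj_on_def)
qed

lemma subtree_value_leaf:
  "v \<in> verts T \<Longrightarrow> v \<notin> inner_verts T \<Longrightarrow> subtree_value T \<theta> a v = 1"
  by (simp add: subtree_value_def leaf_paths_leaf)

lemma subtree_value_inner:
  assumes "v \<in> inner_verts T"
  shows "subtree_value T \<theta> a v =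
    (\<Sum>e\<in>out_arcs T v. a (\<theta> e) * subtree_value T \<theta> a (head T e))"
proof -
  have cons: "(\<Prod>f\<in>set (e # p). a (\<theta> f)) = a (\<theta> e) * (\<Prod>f\<in>set p. a (\<theta> f))"
    if "e \<in> out_arcs T v" "p \<in> leaf_paths T (head T e)" for e p
  proof -
    from that have "e # p \<in> leaf_paths T v"
      unfolding Cons_in_leaf_paths_iff by blast
    then have "e \<notin> set p"
      using distinct_leaf_path by fastforce
    then show ?thesis by simp
  qed
  have "subtree_value T \<theta> a v =
      (\<Sum>e\<in>out_arcs T v. \<Sum>p\<in>(#) e ` leaf_paths T (head T e). \<Prod>f\<in>set p. a (\<theta> f))"
    unfolding subtree_value_def leaf_paths_inner[OF assms]
    by (rule sum.UNION_disjoint) (auto simp: finite_leaf_paths)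
  also have "\<dots> = (\<Sum>e\<in>out_arcs T v. \<Sum>p\<in>leaf_paths T (head T e). \<Prod>f\<in>set (e # p). a (\<theta> f))"
    by (subst sum.reindex) (auto simp: inj_on_def)
  also have "\<dots> = (\<Sum>e\<in>out_arcs T v. a (\<theta> e) * subtree_value T \<theta> a (head T e))"
    unfolding subtree_value_def sum_distrib_left
    by (intro sum.cong refl cons)
  finally show ?thesis .
qed

lemma subtree_value_pos:
  assumes "\<And>l. a l > 0" "v \<in> verts T"
  shows "subtree_value T \<theta> a v > 0"
  unfolding subtree_value_def
  by (intro sum_pos finite_leaf_paths leaf_paths_nonempty prod_pos assms)

lemma subtree_value_eq_parametrisation:
  "subtree_value T \<theta> a v = (\<Sum>f\<in>#parametrisation T \<theta> v. poly_eval a f)"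
  unfolding subtree_value_def parametrisation_def sum_unfold_sum_mset
  by (simp add: image_mset.compositionality comp_def path_monomial_def eval.extension_prod
      eval.extension_indet)

lemma size_parametrisation: "size (parametrisation T \<theta> v) = card (leaf_paths T v)"
  by (simp add: parametrisation_def)

text \<open>
  Multiplying each edge by the quotient of the subtree values at its head and at its tail divides
  the product along a path to a leaf by the value at the start: the quotients telescope.
\<close>

lemma prod_rescaled_leaf_path:
  assumes a: "\<And>l. a l > 0"
    and b: "\<And>e. e \<in> arcs T \<Longrightarrow>
      b (\<theta> e) = a (\<theta> e) * subtree_value T \<theta> a (head T e) / subtree_value T \<theta> a (tail T e)"
    and "p \<in> leaf_paths T v"
  shows "(\<Prod>e\<in>set p. b (\<theta> e)) = (\<Prod>e\<in>set p. a (\<theta> e)) / subtree_value T \<theta> a v"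
  using assms(3)
proof (induction p arbitrary: v)
  case Nil
  then have "v \<in> verts T" "v \<notin> inner_verts T"
    unfolding Nil_in_leaf_paths_iff by blast+
  then show ?case
    by (simp add: subtree_value_leaf)
next
  case (Cons e p)
  then have e: "e \<in> arcs T" "tail T e = v" "e \<notin> set p" and p: "p \<in> leaf_paths T (head T e)"
    using distinct_leaf_path[of "e # p" v] by (simp_all add: Cons_in_leaf_paths_iff)
  note IH = Cons.IH[OF p]
  have "subtree_value T \<theta> a (head T e) > 0"
    using e(1) by (intro subtree_value_pos a) simp
  then show ?case
    using e by (simp add: b IH)
qed

end


section \<open>Staged trees whose stages are positions\<close>

locale positioned_staged_tree = staged_tree T r \<theta> S
  for T :: "('v, 'e) pre_digraph" and r :: 'v and \<theta> :: "'e \<Rightarrow> 'l" and S :: "('v \<times> 'v) set" +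
  assumes same_stage_same_position: "(v, w) \<in> S \<Longrightarrow> same_position T \<theta> S v w"
begin

abbreviation t :: "('l \<Rightarrow> real) \<Rightarrow> 'v \<Rightarrow> real" where
  "t \<equiv> subtree_value T \<theta>"

lemma same_stage_subtree_value: "(v, w) \<in> S \<Longrightarrow> t a v = t a w"
  using same_stage_same_position[of v w]
  by (simp add: same_position_def subtree_value_eq_parametrisation)

lemma same_stage_card_leaf_paths: "(v, w) \<in> S \<Longrightarrow> card (leaf_paths T v) = card (leaf_paths T w)"
  using same_stage_same_position[of v w]
  by (simp add: same_position_def flip: size_parametrisation[of \<theta>])

lemma equal_labels_same_stage:
  assumes "e \<in> arcs T" "f \<in> arcs T" "\<theta> e = \<theta> f"
  shows "(tail T e, tail T f) \<in> S"
proof (rule ccontr)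
  assume "(tail T e, tail T f) \<notin> S"
  moreover have "tail T e \<in> inner_verts T" "tail T f \<in> inner_verts T"
    using assms(1,2) by (auto intro!: out_arc_inner_verts)
  ultimately have "\<theta> ` out_arcs T (tail T e) \<inter> \<theta> ` out_arcs T (tail T f) = {}"
    using different_stage_labels by blast
  moreover have "\<theta> e \<in> \<theta> ` out_arcs T (tail T e)" "\<theta> f \<in> \<theta> ` out_arcs T (tail T f)"
    using assms(1,2) by (simp_all add: imageI)
  ultimately show False
    unfolding assms(3) by blast
qed

text \<open>
  A label at \<open>v\<close> does not return below \<open>v\<close>: a vertex in the stage of \<open>v\<close> has as many leaves below
  it as \<open>v\<close>, but a proper descendant has fewer.
\<close>

lemma label_not_below:
  assumes "e \<in> out_arcs T v" "p \<in> leaf_paths T (head T e)" "f \<in> set p"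
  shows "\<theta> f \<notin> \<theta> ` out_arcs T v"
proof
  assume "\<theta> f \<in> \<theta> ` out_arcs T v"
  then obtain e' where e': "e' \<in> arcs T" "tail T e' = v" "\<theta> f = \<theta> e'"
    by auto
  obtain p1 p2 where p: "p = p1 @ f # p2"
    using assms(3) by (meson split_list)
  obtain w where "awalk (head T e) (p1 @ f # p2) w"
    using assms(2) unfolding in_leaf_paths_iff p by blast
  from awalk_append_ConsE[OF this] assms(1)
  have f: "f \<in> arcs T" "awalk v (e # p1) (tail T f)"
    by (simp_all add: awalk_Cons_iff)
  have "(v, tail T f) \<in> S"
    using equal_labels_same_stage[of e' f] e' f(1) by auto
  then show False
    using same_stage_card_leaf_paths card_leaf_paths_less[OF f(2)] by fastforce
qed

text \<open>
  The value \<open>t a v = (\<Sum>e. a (\<theta> e) * t a (head e))\<close> is affine in the label of each edge \<open>e\<close> at \<open>v\<close>,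
  with slope \<open>t a (head e)\<close>.
\<close>

lemma subtree_value_increment:
  assumes e: "e \<in> out_arcs T v"
  shows "t (a(\<theta> e := a (\<theta> e) + 1)) v = t a v + t a (head T e)"
proof -
  let ?a' = "a(\<theta> e := a (\<theta> e) + 1)"
  from e have v: "v \<in> inner_verts T"
    by (rule out_arc_inner_verts)
  have below: "t ?a' (head T f) = t a (head T f)" if f: "f \<in> out_arcs T v" for f
  proof -
    have "\<theta> g \<noteq> \<theta> e" if "p \<in> leaf_paths T (head T f)" "g \<in> set p" for p g
      using label_not_below[OF f that] e by auto
    then show ?thesis
      unfolding subtree_value_def by (intro sum.cong prod.cong) auto
  qed
  have label: "\<theta> f = \<theta> e \<longleftrightarrow> f = e" if "f \<in> out_arcs T v" for f
    using inj_on_labels[OF v] e that by (auto dest: inj_onD)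
  have "t ?a' v = (\<Sum>f\<in>out_arcs T v. a (\<theta> f) * t a (head T f) +
      (if f = e then t a (head T e) else 0))"
    unfolding subtree_value_inner[OF v]
    by (intro sum.cong refl) (simp add: below label distrib_right)
  also have "\<dots> = t a v + t a (head T e)"
    using e by (simp add: sum.distrib subtree_value_inner[OF v] finite_out_arcs sum.delta
        del: in_out_arcs_conv)
  finally show ?thesis .
qed

text \<open>
  The tails are in the same position and have the same value at every point, so the slopes of this
  value in the common label agree.
\<close>

lemma equal_labels_head_value:
  assumes "e \<in> arcs T" "f \<in> arcs T" "\<theta> e = \<theta> f"
  shows "t a (head T e) = t a (head T f)"
  using subtree_value_increment[of e "tail T e" a] subtree_value_increment[of f "tail T f" a]
    same_stage_subtree_value[OF equal_labels_same_stage[OF assms]] assms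
  by simp

text \<open>
  The right-hand side depends only on the label of \<open>e\<close>, so \<open>b\<close> can be computed from any edge with the
  given label.
\<close>

lemma rescaling_exists:
  obtains b where "\<And>e. e \<in> arcs T \<Longrightarrow> b (\<theta> e) = a (\<theta> e) * t a (head T e) / t a (tail T e)"
proof
  define c where "c l = (SOME e. e \<in> arcs T \<and> \<theta> e = l)" for l
  fix e
  assume e: "e \<in> arcs T"
  then have "c (\<theta> e) \<in> arcs T \<and> \<theta> (c (\<theta> e)) = \<theta> e"
    unfolding c_def by (intro someI[of "\<lambda>e'. e' \<in> arcs T \<and> \<theta> e' = \<theta> e" e]) simp
  then show "(\<lambda>l. a l * t a (head T (c l)) / t a (tail T (c l))) (\<theta> e) =
      a (\<theta> e) * t a (head T e) / t a (tail T e)"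
    using equal_labels_head_value[of "c (\<theta> e)" e]
      same_stage_subtree_value[OF equal_labels_same_stage[of "c (\<theta> e)" e]] e
    by simp
qed

lemma label_sum_in_label_ring:
  "(\<Sum>e\<in>out_arcs T v. indet (\<theta> e)) - 1 \<in> carrier (label_ring T \<theta>)"
  by (intro poly_ring_diff poly_ring_sum poly_ring_indet poly_ring_1) auto

lemma sum_to_one_ideal_ideal: "ideal (sum_to_one_ideal T \<theta>) (label_ring T \<theta>)"
proof -
  interpret R: cring "label_ring T \<theta>" by (rule poly_ring_cring)
  show ?thesis
    unfolding sum_to_one_ideal_def
    using label_sum_in_label_ring by (intro R.genideal_ideal) auto
qed

text \<open>At \<open>b\<close> the labels at an inner vertex \<open>v\<close> have the sum \<open>t a v / t a v = 1\<close>.\<close>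

lemma poly_eval_sum_to_one_ideal:
  assumes a: "\<And>l. a l > 0"
    and b: "\<And>e. e \<in> arcs T \<Longrightarrow> b (\<theta> e) = a (\<theta> e) * t a (head T e) / t a (tail T e)"
    and f: "f \<in> sum_to_one_ideal T \<theta>"
  shows "poly_eval b f = 0"
proof -
  interpret R: cring "label_ring T \<theta>" by (rule poly_ring_cring)
  have "(\<Sum>e\<in>out_arcs T v. b (\<theta> e)) = 1" if v: "v \<in> inner_verts T" for v
  proof -
    have "(\<Sum>e\<in>out_arcs T v. b (\<theta> e)) = (\<Sum>e\<in>out_arcs T v. a (\<theta> e) * t a (head T e) / t a v)"
      by (intro sum.cong) (auto simp: b)
    also have "\<dots> = t a v / t a v"
      by (simp only: subtree_value_inner[OF v, of \<theta> a] flip: sum_divide_distrib)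
    also have "\<dots> = 1"
      using subtree_value_pos[of a v \<theta>] a v by (auto simp: inner_verts_def)
    finally show ?thesis .
  qed
  then have "poly_eval b ((\<Sum>e\<in>out_arcs T v. indet (\<theta> e)) - 1) = 0" if "v \<in> inner_verts T" for v
    using that by (simp add: eval.extension_diff eval.extension_sum eval.extension_indet)
  then have "sum_to_one_ideal T \<theta> \<subseteq> {f \<in> carrier (label_ring T \<theta>). poly_eval b f = 0}"
    unfolding sum_to_one_ideal_def
    using label_sum_in_label_ring
    by (intro R.genideal_minimal zero_set_ideal eval.extension_add eval.extension_mult) auto
  with f show ?thesis by blast
qed

lemma path_monomial_in_label_ring:
  "p \<in> leaf_paths T r \<Longrightarrow> path_monomial \<theta> p \<in> carrier (label_ring T \<theta>)"
  unfolding path_monomial_def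
  using leaf_path_subset_arcs by (intro poly_ring_prod poly_ring_indet) blast

lemma poly_eval_path_monomial: "poly_eval a (path_monomial \<theta> p) = (\<Prod>e\<in>set p. a (\<theta> e))"
  by (simp add: path_monomial_def eval.extension_prod eval.extension_indet)

text \<open>
  At the rescaled point \<open>b\<close> all path monomials are those at \<open>a\<close> divided by the common factor
  \<open>t a r\<close>, which does not affect whether a homogeneous polynomial vanishes. At \<open>b\<close> the polynomial
  vanishes because it lies in the ideal.
\<close>

lemma homogeneous_subst_in_sum_to_one_ideal:
  assumes f: "f \<in> carrier (path_ring T r)" and "homogeneous f"
    and ideal: "poly_subst (path_monomial \<theta>) f \<in> sum_to_one_ideal T \<theta>"
  shows "poly_subst (path_monomial \<theta>) f = 0"
proof (rule poly_eq_0_if_eval_eq_0)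
  fix a :: "'l \<Rightarrow> real"
  assume a: "\<And>l. a l > 0"
  obtain b where b: "\<And>e. e \<in> arcs T \<Longrightarrow> b (\<theta> e) = a (\<theta> e) * t a (head T e) / t a (tail T e)"
    using rescaling_exists[of a] by blast
  have "0 = poly_eval b (poly_subst (path_monomial \<theta>) f)"
    using poly_eval_sum_to_one_ideal[OF a b ideal] by simp
  also have "\<dots> = poly_eval (\<lambda>p. inverse (t a r) * (\<Prod>e\<in>set p. a (\<theta> e))) f"
    unfolding poly_eval_subst
  proof (rule poly_extension_cong[OF f])
    fix p
    assume "p \<in> leaf_paths T r"
    from prod_rescaled_leaf_path[OF a b this]
    show "poly_eval b (path_monomial \<theta> p) = inverse (t a r) * (\<Prod>e\<in>set p. a (\<theta> e))"
      by (simp add: poly_eval_path_monomial divide_inverse_commute)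
  qed
  finally show "poly_eval a (poly_subst (path_monomial \<theta>) f) = 0"
    using poly_eval_scaled_homogeneous[OF \<open>homogeneous f\<close>, of "inverse (t a r)"]
      subtree_value_pos[where a = a and \<theta> = \<theta>, OF a root_in_verts]
    by (simp add: poly_eval_subst poly_eval_path_monomial)
qed

lemma param_map_eq_zero_iff:
  assumes "f \<in> carrier (path_ring T r)"
  shows "param_map T \<theta> f = \<zero>\<^bsub>label_ring T \<theta> Quot sum_to_one_ideal T \<theta>\<^esub> \<longleftrightarrow>
    poly_subst (path_monomial \<theta>) f \<in> sum_to_one_ideal T \<theta>"
proof -
  interpret R: cring "label_ring T \<theta>" by (rule poly_ring_cring)
  have "poly_subst (path_monomial \<theta>) f \<in> carrier (label_ring T \<theta>)"
    using poly_subst_in_poly_ring[OF assms path_monomial_in_label_ring] .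
  then show ?thesis
    unfolding param_map_def FactRing_def
    using R.a_rcos_zero[OF sum_to_one_ideal_ideal]
      ideal.rcos_const_imp_mem[OF sum_to_one_ideal_ideal]
    by auto
qed

lemma homogeneous_param_kernel:
  "{f \<in> a_kernel (path_ring T r) (label_ring T \<theta> Quot sum_to_one_ideal T \<theta>) (param_map T \<theta>).
      homogeneous f} =
   {f \<in> carrier (path_ring T r). homogeneous f \<and> poly_subst (path_monomial \<theta>) f = 0}"
proof -
  have "0 \<in> sum_to_one_ideal T \<theta>"
    using additive_subgroup.zero_closed[OF ideal.axioms(1)[OF sum_to_one_ideal_ideal]] by simp
  then show ?thesis
    unfolding a_kernel_def' mem_Collect_eq
    by (intro Collect_cong) (metis homogeneous_subst_in_sum_to_one_ideal param_map_eq_zero_iff)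
qed

lemma path_monomial_single:
  "path_monomial \<theta> p = Poly_Mapping.single (\<Sum>e\<in>set p. Poly_Mapping.single (\<theta> e) 1) 1"
proof -
  have "(\<Prod>e\<in>A. indet (\<theta> e)) = Poly_Mapping.single (\<Sum>e\<in>A. Poly_Mapping.single (\<theta> e) 1) 1" for A
    by (induction A rule: infinite_finite_induct) (simp_all add: indet_def mult_single)
  then show ?thesis
    by (simp add: path_monomial_def)
qed

theorem toric_model: "toric_staged_tree_model T r \<theta>"
  unfolding toric_staged_tree_model_def param_kernel_def homogeneous_param_kernel
proof (subst path_monomial_single[abs_def], rule toric_ideal_homogeneous_monomial_relations)
  show "finite (\<theta> ` arcs T)"
    by simp
  show "Poly_Mapping.keys (\<Sum>e\<in>set p. Poly_Mapping.single (\<theta> e) (1::nat)) \<subseteq> \<theta> ` arcs T"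
    if "p \<in> leaf_paths T r" for p
    by (rule order.trans[OF Poly_Mapping.keys_sum]) (use leaf_path_subset_arcs[OF that] in auto)
qed

end

theorem corollary11:
  fixes T :: "('v, 'e) pre_digraph" and r :: 'v
    and \<theta> :: "'e \<Rightarrow> 'l" and S :: "('v \<times> 'v) set"
  assumes "staged_tree T r \<theta> S"
    and "\<And>v w. (v, w) \<in> S \<Longrightarrow> same_position T \<theta> S v w"
  shows "toric_staged_tree_model T r \<theta>"
proof -
  interpret staged_tree T r \<theta> S by fact
  interpret positioned_staged_tree T r \<theta> S
    by unfold_locales fact
  show ?thesis by (rule toric_model)
qed

end
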